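(* Let $n\ge 1$, let $f:\mathbb{R}^n\to\mathbb{R}^n$ be continuous, and let $\mathcal{X}\subseteq\mathbb{R}^n$ be open, connected, and forward invariant for the system $x_{k+1}=f(x_k)$. Let $\epsilon>0$. Suppose there exist $\mu>0$, $\rho\in(0,1)$ and a uniformly continuous function $M:\mathcal{X}\to\mathbb{S}^{n\times n}_{++}$ with $\mu I\preceq M(x)$ for all $x\in\mathcal{X}$, such that $$\sqrt{(f(x)-f(y))^\top M(f(x))(f(x)-f(y))}\;\le\;\rho\,\sqrt{(x-y)^\top M(x)(x-y)}$$ for all $x\in\mathcal{X}$ and all $y\in B(x;\epsilon)\cap\mathcal{X}$. For $x,y\in\mathcal{X}$ define $$d(x,y):=\inf_{\gamma\in\Gamma_{x,y}}L(\gamma),$$ where $\Gamma_{x,y}$ is the set of admissible curves in $\mathcal{X}$ from $x$ to $y$ and $L(\gamma)$ is the length of $\gamma$ under $M$ (both defined in the context). Then the system $x_{k+1}=f(x_k)$ is contracting on $\mathcal{X}$ in the metric $d$; that is, $d$ is a metric on $\mathcal{X}$ and there exists $\rho'\in(0,1)$ such that $d(f(x),f(y))\le\rho'\,d(x,y)$ for all $x,y\in\mathcal{X}$.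
   Context: $\mathbb{S}^{n\times n}_{++}$ is the set of real symmetric positive definite $n\times n$ matrices; $A\preceq B$ means that $B-A$ is positive semidefinite. $B(x;\epsilon)=\{y\in\mathbb{R}^n:\|y-x\|_\infty\le\epsilon\}$ is the closed ball in the infinity norm. Forward invariance of $\mathcal{X}$ means $f(\mathcal{X})\subseteq\mathcal{X}$. A metric on $\mathcal{X}$ is a function $d:\mathcal{X}\times\mathcal{X}\to\mathbb{R}_{\ge 0}$ satisfying the usual metric axioms. Contracting: the system $x_{k+1}=f(x_k)$ is contracting on a forward invariant set $\mathcal{X}$ in a metric $d$ if there is a scalar $\rho'\in(0,1)$ (a contraction rate) with $d(f(x),f(y))\le\rho' d(x,y)$ for all $x,y\in\mathcal{X}$. Admissible curves: for nonnegative reals $a\le b$, $\Gamma_{a,b}$ is the set of maps $\gamma:[a,b]\to\mathcal{X}$ that are continuous and piecewise regular, where piecewise regular means that $[a,b]$ can be divided into finitely many closed subintervals such that on each of them $\gamma$ is $C^1$ (one-sided derivatives at endpoints) and $\|\gamma'(t)\|\ne 0$ for all $t$. A curve on a degenerate interval $a=b$ is (vacuously) admissible and has length $0$. For $x,y\in\mathcal{X}$, $\Gamma_{x,y}:=\bigcup_{0\le a\le b}\{\gamma\in\Gamma_{a,b}:\gamma(a)=x,\ \gamma(b)=y\}$. Length of an admissible curve $\gamma:[a,b]\to\mathcal{X}$ under $M$: $L(\gamma):=\int_a^b\sqrt{\gamma'(t)^\top M(\gamma(t))\gamma'(t)}\,dt$. *)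

theory Defs
  imports "HOL-Analysis.Analysis"
begin

definition pos_def :: "real^'n^'n \<Rightarrow> bool" where
  "pos_def A \<longleftrightarrow> transpose A = A \<and> (\<forall>v. v \<noteq> 0 \<longrightarrow> 0 < v \<bullet> (A *v v))"

definition pos_semidef :: "real^'n^'n \<Rightarrow> bool" where
  "pos_semidef A \<longleftrightarrow> transpose A = A \<and> (\<forall>v. 0 \<le> v \<bullet> (A *v v))"

definition loewner_le :: "real^'n^'n \<Rightarrow> real^'n^'n \<Rightarrow> bool" where
  "loewner_le A B \<longleftrightarrow> pos_semidef (B - A)"

definition inf_ball :: "real^'n \<Rightarrow> real \<Rightarrow> (real^'n) set" where
  "inf_ball x \<epsilon> = {y. infnorm (y - x) \<le> \<epsilon>}"

definition forward_invariant :: "('a \<Rightarrow> 'a) \<Rightarrow> 'a set \<Rightarrow> bool" where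
  "forward_invariant f X \<longleftrightarrow> f ` X \<subseteq> X"

definition contracting_in :: "('a \<Rightarrow> 'a) \<Rightarrow> 'a set \<Rightarrow> ('a \<Rightarrow> 'a \<Rightarrow> real) \<Rightarrow> bool" where
  "contracting_in f X d \<longleftrightarrow>
     (\<exists>\<rho>'. 0 < \<rho>' \<and> \<rho>' < 1 \<and> (\<forall>x\<in>X. \<forall>y\<in>X. d (f x) (f y) \<le> \<rho>' * d x y))"

text \<open>
  The derivative is taken within \<open>{c..d}\<close>, so it is one-sided at the endpoints. The library's
  \<open>C1_differentiable_on\<close> takes two-sided derivatives, and \<open>piecewise_C1_differentiable_on\<close> does not
  require the derivative to have limits at the break points, so neither is used here.
\<close>

definition C1_regular_on :: "(real \<Rightarrow> real^'n) \<Rightarrow> real \<Rightarrow> real \<Rightarrow> bool" where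
  "C1_regular_on \<gamma> c d \<longleftrightarrow>
     (\<exists>\<gamma>'. continuous_on {c..d} \<gamma>' \<and>
        (\<forall>t\<in>{c..d}. (\<gamma> has_vector_derivative \<gamma>' t) (at t within {c..d}) \<and> norm (\<gamma>' t) \<noteq> 0))"

text \<open>
  The subdivision is \<open>a = p 0 < \<dots> < p N = b\<close>. The case \<open>N = 0\<close> is exactly the
  degenerate interval \<open>a = b\<close>, where every map is piecewise regular.
\<close>

definition piecewise_regular_on :: "(real \<Rightarrow> real^'n) \<Rightarrow> real \<Rightarrow> real \<Rightarrow> bool" where
  "piecewise_regular_on \<gamma> a b \<longleftrightarrow>
     (\<exists>(N::nat) (p :: nat \<Rightarrow> real). p 0 = a \<and> p N = b \<and>
        (\<forall>i<N. p i < p (Suc i) \<and> C1_regular_on \<gamma> (p i) (p (Suc i))))"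

text \<open>A curve on \<open>{a..b}\<close> is a total function of which only the values on \<open>{a..b}\<close> matter.\<close>

definition admissible_curve :: "(real^'n) set \<Rightarrow> real \<Rightarrow> real \<Rightarrow> (real \<Rightarrow> real^'n) \<Rightarrow> bool" where
  "admissible_curve X a b \<gamma> \<longleftrightarrow>
     0 \<le> a \<and> a \<le> b \<and> \<gamma> ` {a..b} \<subseteq> X \<and> continuous_on {a..b} \<gamma> \<and> piecewise_regular_on \<gamma> a b"

definition admissible_curves_between ::
    "(real^'n) set \<Rightarrow> real^'n \<Rightarrow> real^'n \<Rightarrow> (real \<times> real \<times> (real \<Rightarrow> real^'n)) set" where
  "admissible_curves_between X x y =
     {(a, b, \<gamma>). admissible_curve X a b \<gamma> \<and> \<gamma> a = x \<and> \<gamma> b = y}"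

text \<open>
  At a break point of \<open>\<gamma>\<close> the value of \<open>vector_derivative\<close> may be arbitrary; there are only
  finitely many of these, so they do not affect the integral.
\<close>

definition curve_length ::
    "(real^'n \<Rightarrow> real^'n^'n) \<Rightarrow> real \<Rightarrow> real \<Rightarrow> (real \<Rightarrow> real^'n) \<Rightarrow> real" where
  "curve_length M a b \<gamma> =
     integral {a..b} (\<lambda>t. let v = vector_derivative \<gamma> (at t within {a..b})
                          in sqrt (v \<bullet> (M (\<gamma> t) *v v)))"

text \<open>
  The distance is meaningful only for points of \<open>X\<close>. It is extended by \<open>0\<close> because the locale
  \<open>Metric_space\<close> asks for nonnegativity and symmetry on the whole type; the remaining metric
  axioms are asked for on \<open>X\<close> only. For open connected \<open>X\<close> the infimum is over a nonempty set.
\<close>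

definition curve_dist ::
    "(real^'n) set \<Rightarrow> (real^'n \<Rightarrow> real^'n^'n) \<Rightarrow> real^'n \<Rightarrow> real^'n \<Rightarrow> real" where
  "curve_dist X M x y =
     (if x \<in> X \<and> y \<in> X
      then INF (a, b, \<gamma>) \<in> admissible_curves_between X x y. curve_length M a b \<gamma>
      else 0)"

end

theory Submission
  imports Defs
begin

text \<open>
  Write \<open>|v|\<^sub>z\<close> for the norm of \<open>v\<close> given by the matrix \<open>M z\<close>. The path metric \<open>d\<close> satisfies the
  triangle inequality and symmetry because curves can be joined and reversed, it is finite because
  a connected open set is connected by polygons, and it separates points because \<open>\<mu> I \<preceq> M\<close> makes
  every curve at least \<open>sqrt \<mu>\<close> times as long as its Euclidean chord.

  For the contraction one would like to compare a curve \<open>\<gamma>\<close> with its image under \<open>f\<close>, but \<open>f\<close> is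
  only continuous, so \<open>f \<circ> \<gamma>\<close> need not be an admissible curve. It is replaced by a fine polygon
  inscribed in it. Fix \<open>K > 1\<close>. Uniform continuity of \<open>M\<close> and the lower bound \<open>\<mu>\<close> give a \<open>\<delta>\<close> such
  that \<open>|v|\<^sub>z \<le> K |v|\<^sub>w\<close> for all \<open>v\<close> whenever \<open>z\<close> and \<open>w\<close> are \<open>\<delta>\<close>-close
  (\<open>mnorm_uniformly_comparable\<close>). For close parameters \<open>s \<le> t\<close>, put \<open>p = \<gamma> s\<close> and \<open>q = \<gamma> t\<close>. Then
  \<open>d (f p) (f q) \<le> K |f q - f p|\<^sub>f\<^sub>p\<close>, as the segment between the images lies in \<open>X\<close>
  (\<open>curve_dist_le_segment\<close>); the hypothesis on \<open>f\<close> bounds this by \<open>K \<rho> |q - p|\<^sub>p\<close>; and this is at most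
  \<open>K \<rho> K\<close> times the length of \<open>\<gamma>\<close> between \<open>s\<close> and \<open>t\<close> (\<open>chord_le_integral_speed\<close>). Since length is
  additive and \<open>d\<close> satisfies the triangle inequality, such local bounds add up to
  \<open>d (f x) (f y) \<le> K\<^sup>2 \<rho> L(\<gamma>)\<close> for every \<open>\<gamma>\<close> from \<open>x\<close> to \<open>y\<close>. The constant \<open>K\<close> does not depend on the
  curve, so choosing it with \<open>K\<^sup>2 \<rho> = sqrt \<rho> < 1\<close> and taking the infimum over \<open>\<gamma>\<close> finishes the proof.
\<close>

section \<open>The norm given by a positive definite matrix\<close>

definition mnorm :: "real^'n^'n \<Rightarrow> real^'n \<Rightarrow> real" where
  "mnorm A v = sqrt (v \<bullet> (A *v v))"

lemma mnorm_zero [simp]: "mnorm A 0 = 0"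
  by (simp add: mnorm_def)

lemma mnorm_minus [simp]: "mnorm A (- v) = mnorm A v"
proof -
  have "A *v (- v) = - (A *v v)"
    using matrix_vector_mult_scaleR[of A "-1" v] by simp
  then show ?thesis by (simp add: mnorm_def)
qed

lemma mnorm_nonneg: "pos_def A \<Longrightarrow> 0 \<le> mnorm A v"
  unfolding mnorm_def pos_def_def
  by (metis inner_zero_left less_imp_le order_refl real_sqrt_ge_0_iff)

lemma mnorm_power2: "pos_def A \<Longrightarrow> (mnorm A v)\<^sup>2 = v \<bullet> (A *v v)"
  by (metis mnorm_def mnorm_nonneg real_sqrt_ge_0_iff real_sqrt_pow2)

text \<open>The usual discriminant argument: the quadratic form is nonnegative at the point of the line
  \<open>v - r w\<close> where it is minimal.\<close>

lemma mnorm_Cauchy_Schwarz: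
  fixes A :: "real^'n^'n"
  assumes "pos_def A"
  shows "v \<bullet> (A *v w) \<le> mnorm A v * mnorm A w"
proof (cases "w = 0")
  case True
  then show ?thesis by simp
next
  case False
  define q where "q = (\<lambda>u. u \<bullet> (A *v u))"
  have sym: "w \<bullet> (A *v v) = v \<bullet> (A *v w)"
    by (metis assms dot_lmul_matrix inner_commute pos_def_def transpose_matrix_vector)
  have qw: "q w > 0"
    using assms False by (simp add: q_def pos_def_def)
  define r where "r = (v \<bullet> (A *v w)) / q w"
  have "0 \<le> q (v - r *\<^sub>R w)"
    using assms mnorm_power2[of A "v - r *\<^sub>R w"] by (metis q_def zero_le_power2)
  also have "q (v - r *\<^sub>R w) = q v - 2 * r * (v \<bullet> (A *v w)) + r\<^sup>2 * q w"
    by (simp add: q_def sym algebra_simps inner_diff_left inner_diff_right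
        matrix_vector_mult_scaleR power2_eq_square)
  also have "\<dots> = q v - (v \<bullet> (A *v w))\<^sup>2 / q w"
    using qw by (simp add: r_def field_simps power2_eq_square)
  finally have "(v \<bullet> (A *v w))\<^sup>2 \<le> q v * q w"
    using qw by (simp add: field_simps)
  also have "\<dots> = (mnorm A v * mnorm A w)\<^sup>2"
    using assms by (simp add: q_def power_mult_distrib mnorm_power2)
  finally show ?thesis
    using assms by (meson mnorm_nonneg mult_nonneg_nonneg power2_le_imp_le)
qed

lemma norm_le_mnorm:
  fixes A :: "real^'n^'n"
  assumes "loewner_le (\<mu> *\<^sub>R mat 1) A" and "\<mu> > 0"
  shows "sqrt \<mu> * norm v \<le> mnorm A v"
proof -
  have "(\<mu> *\<^sub>R mat 1 :: real^'n^'n) *v v = \<mu> *\<^sub>R v"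
    by (metis matrix_vector_mul_lid scaleR_matrix_vector_assoc)
  then have "\<mu> * (v \<bullet> v) \<le> v \<bullet> (A *v v)"
    using assms(1)
    by (auto simp: loewner_le_def pos_semidef_def matrix_vector_mult_diff_rdistrib inner_diff_right
        dest!: spec[of _ v])
  then have "sqrt (\<mu> * (norm v)\<^sup>2) \<le> mnorm A v"
    by (simp add: mnorm_def power2_norm_eq_inner)
  then show ?thesis by (simp add: real_sqrt_mult)
qed

lemma bounded_bilinear_matrix_vector:
  "bounded_bilinear ((*v) :: real^'n^'m \<Rightarrow> real^'n \<Rightarrow> real^'m)"
proof -
  have "bilinear ((*v) :: real^'n^'m \<Rightarrow> real^'n \<Rightarrow> real^'m)"
    unfolding bilinear_def linear_iff
    by (auto simp: matrix_vector_mult_add_rdistrib matrix_vector_right_distrib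
        matrix_vector_mult_scaleR scaleR_matrix_vector_assoc)
  then show ?thesis
    by (simp add: bilinear_conv_bounded_bilinear)
qed

lemma continuous_on_mnorm:
  fixes A :: "real \<Rightarrow> real^'n^'n"
  assumes "continuous_on S A" and "continuous_on S v"
  shows "continuous_on S (\<lambda>t. mnorm (A t) (v t))"
  unfolding mnorm_def
  by (intro continuous_on_real_sqrt continuous_on_inner assms
      bounded_bilinear.continuous_on[OF bounded_bilinear_matrix_vector])

text \<open>The lower bound \<open>\<mu> I\<close> turns an additive perturbation of \<open>M\<close> into a multiplicative one: a
  change of size \<open>\<eta>\<close> in the matrix changes the quadratic form by at most \<open>\<eta> |v|\<^sup>2\<close>, which is at
  most \<open>\<eta> / \<mu>\<close> times the form itself.\<close>

lemma mnorm_uniformly_comparable: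
  fixes M :: "real^'n \<Rightarrow> real^'n^'n"
  assumes uc: "uniformly_continuous_on X M" and "\<mu> > 0"
    and lb: "\<forall>x\<in>X. loewner_le (\<mu> *\<^sub>R mat 1) (M x)"
    and pd: "\<forall>x\<in>X. pos_def (M x)"
    and "K > 1"
  obtains \<delta> where "\<delta> > 0"
    "\<And>x y v. x \<in> X \<Longrightarrow> y \<in> X \<Longrightarrow> dist x y < \<delta> \<Longrightarrow> mnorm (M x) v \<le> K * mnorm (M y) v"
proof -
  obtain C where "C > 0" and C: "\<And>(A::real^'n^'n) v::real^'n. norm (A *v v) \<le> norm A * norm v * C"
    using bounded_bilinear.pos_bounded[OF bounded_bilinear_matrix_vector] by metis
  define \<eta> where "\<eta> = (K\<^sup>2 - 1) * \<mu> / C"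
  have "1 < K\<^sup>2"
    using \<open>K > 1\<close> by simp
  then have "\<eta> > 0"
    using \<open>\<mu> > 0\<close> \<open>C > 0\<close> by (simp add: \<eta>_def)
  then obtain \<delta> where "\<delta> > 0" and \<delta>: "\<And>x y. x \<in> X \<Longrightarrow> y \<in> X \<Longrightarrow> dist x y < \<delta> \<Longrightarrow> dist (M x) (M y) < \<eta>"
    using uc unfolding uniformly_continuous_on_def by metis
  show thesis
  proof (rule that[OF \<open>\<delta> > 0\<close>])
    fix x y v assume xy: "x \<in> X" "y \<in> X" "dist x y < \<delta>"
    have "v \<bullet> (M x *v v) - v \<bullet> (M y *v v) = v \<bullet> ((M x - M y) *v v)"
      by (simp add: matrix_vector_mult_diff_rdistrib inner_diff_right)
    also have "\<dots> \<le> norm v * norm ((M x - M y) *v v)"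
      by (rule norm_cauchy_schwarz)
    also have "\<dots> \<le> norm v * (norm (M x - M y) * norm v * C)"
      by (intro mult_left_mono C) simp
    also have "\<dots> = norm (M x - M y) * (C * (norm v)\<^sup>2)"
      by (simp add: power2_eq_square)
    also have "\<dots> \<le> \<eta> * (C * (norm v)\<^sup>2)"
      using \<delta>[OF xy] \<open>C > 0\<close> by (intro mult_right_mono) (auto simp: dist_norm)
    also have "\<dots> = (K\<^sup>2 - 1) * (sqrt \<mu> * norm v)\<^sup>2"
      using \<open>C > 0\<close> \<open>\<mu> > 0\<close> by (simp add: \<eta>_def power_mult_distrib)
    also have "\<dots> \<le> (K\<^sup>2 - 1) * (mnorm (M y) v)\<^sup>2"
      using norm_le_mnorm[OF bspec[OF lb xy(2)] \<open>\<mu> > 0\<close>] \<open>1 < K\<^sup>2\<close> \<open>\<mu> > 0\<close>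
      by (intro mult_left_mono power_mono) auto
    finally have "(mnorm (M x) v)\<^sup>2 \<le> (K * mnorm (M y) v)\<^sup>2"
      using pd xy by (simp add: mnorm_power2 power_mult_distrib algebra_simps)
    then show "mnorm (M x) v \<le> K * mnorm (M y) v"
      using pd xy \<open>K > 1\<close> by (meson mnorm_nonneg mult_nonneg_nonneg power2_le_imp_le less_imp_le
          less_trans zero_less_one)
  qed
qed

section \<open>Piecewise regular curves\<close>

lemma piecewise_regular_on_refl: "piecewise_regular_on \<gamma> a a"
  unfolding piecewise_regular_on_def by (intro exI[of _ 0] exI[of _ "\<lambda>_. a"]) simp

lemma piecewise_regular_on_step:
  assumes "piecewise_regular_on \<gamma> a b" and "b < c" and "C1_regular_on \<gamma> b c"
  shows "piecewise_regular_on \<gamma> a c"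
proof -
  obtain N p where "p 0 = a" "p N = b" "\<forall>i<N. p i < p (Suc i) \<and> C1_regular_on \<gamma> (p i) (p (Suc i))"
    using assms(1) unfolding piecewise_regular_on_def by blast
  then show ?thesis
    unfolding piecewise_regular_on_def using assms(2,3)
    by (intro exI[of _ "Suc N"] exI[of _ "p(Suc N := c)"]) (auto simp: less_Suc_eq)
qed

text \<open>Together with the two preceding rules, this presents piecewise regularity as an inductive
  predicate, so that the subdivision points never have to be handled again.\<close>

lemma piecewise_regular_on_induct [consumes 1, case_names refl step]:
  assumes "piecewise_regular_on \<gamma> a b"
    and refl: "P a"
    and step: "\<And>b c. a \<le> b \<Longrightarrow> b < c \<Longrightarrow> piecewise_regular_on \<gamma> a b \<Longrightarrow> C1_regular_on \<gamma> b c \<Longrightarrow> P b \<Longrightarrow> P c"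
  shows "P b"
proof -
  obtain N p where p: "p 0 = a" "p N = b" "\<forall>i<N. p i < p (Suc i) \<and> C1_regular_on \<gamma> (p i) (p (Suc i))"
    using assms(1) unfolding piecewise_regular_on_def by blast
  have "a \<le> p k \<and> piecewise_regular_on \<gamma> a (p k) \<and> P (p k)" if "k \<le> N" for k
    using that
  proof (induction k)
    case 0
    then show ?case using refl p by (simp add: piecewise_regular_on_refl)
  next
    case (Suc k)
    then have "p k < p (Suc k)" "C1_regular_on \<gamma> (p k) (p (Suc k))"
      using p(3) by auto
    with Suc show ?case
      by (auto intro: step piecewise_regular_on_step)
  qed
  then show ?thesis using p(2) by blast
qed

lemma piecewise_regular_on_trans:
  assumes "piecewise_regular_on \<gamma> a b" and "piecewise_regular_on \<gamma> b c"
  shows "piecewise_regular_on \<gamma> a c"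
  using assms(2)
  by (induction rule: piecewise_regular_on_induct) (auto intro: assms(1) piecewise_regular_on_step)

lemma C1_regular_on_cong:
  assumes "C1_regular_on \<gamma> a b" and "\<And>t. t \<in> {a..b} \<Longrightarrow> \<gamma> t = \<gamma>' t"
  shows "C1_regular_on \<gamma>' a b"
proof -
  obtain D where "continuous_on {a..b} D"
    and D: "\<And>t. t \<in> {a..b} \<Longrightarrow> (\<gamma> has_vector_derivative D t) (at t within {a..b}) \<and> norm (D t) \<noteq> 0"
    using assms(1) unfolding C1_regular_on_def by blast
  moreover have "(\<gamma>' has_vector_derivative D t) (at t within {a..b})" if "t \<in> {a..b}" for t
    by (rule has_vector_derivative_transform[of _ _ _ \<gamma>]) (use that assms(2) D in auto)
  ultimately show ?thesis
    unfolding C1_regular_on_def by blast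
qed

lemma piecewise_regular_on_cong:
  assumes "piecewise_regular_on \<gamma> a b" and "\<And>t. t \<in> {a..b} \<Longrightarrow> \<gamma> t = \<gamma>' t"
  shows "piecewise_regular_on \<gamma>' a b"
proof -
  have "(\<forall>t\<in>{a..b}. \<gamma> t = \<gamma>' t) \<longrightarrow> piecewise_regular_on \<gamma>' a b"
    using assms(1)
  proof (induction rule: piecewise_regular_on_induct)
    case refl
    show ?case by (simp add: piecewise_regular_on_refl)
  next
    case (step b c)
    then show ?case
      by (auto intro!: piecewise_regular_on_step[of _ a b c] elim!: C1_regular_on_cong)
  qed
  with assms(2) show ?thesis by blast
qed

lemma C1_regular_on_reflect:
  assumes "C1_regular_on \<gamma> a b"
  shows "C1_regular_on (\<lambda>t. \<gamma> (C - t)) (C - b) (C - a)"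
proof -
  obtain \<gamma>' where cont: "continuous_on {a..b} \<gamma>'"
    and der: "\<And>t. t \<in> {a..b} \<Longrightarrow> (\<gamma> has_vector_derivative \<gamma>' t) (at t within {a..b})"
    and nz: "\<And>t. t \<in> {a..b} \<Longrightarrow> norm (\<gamma>' t) \<noteq> 0"
    using assms unfolding C1_regular_on_def by blast
  have im: "(\<lambda>t. C - t) ` {C - b..C - a} = {a..b}"
    by simp
  have "continuous_on {C - b..C - a} (\<lambda>t. - \<gamma>' (C - t))"
    by (intro continuous_intros continuous_on_compose2[OF cont]) auto
  moreover have "((\<lambda>t. \<gamma> (C - t)) has_vector_derivative - \<gamma>' (C - t)) (at t within {C - b..C - a})"
    if "t \<in> {C - b..C - a}" for t
  proof -
    have "((\<lambda>t. C - t) has_vector_derivative -1) (at t within {C - b..C - a})"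
      by (auto intro!: derivative_eq_intros)
    moreover have "(\<gamma> has_vector_derivative \<gamma>' (C - t)) (at (C - t) within (\<lambda>t. C - t) ` {C - b..C - a})"
      unfolding im using that by (intro der) auto
    ultimately show ?thesis
      using vector_diff_chain_within[of "\<lambda>t. C - t"] by (fastforce simp: o_def)
  qed
  moreover have "norm (- \<gamma>' (C - t)) \<noteq> 0" if "t \<in> {C - b..C - a}" for t
    using nz[of "C - t"] that by auto
  ultimately show ?thesis
    unfolding C1_regular_on_def by blast
qed

lemma piecewise_regular_on_reflect:
  assumes "piecewise_regular_on \<gamma> a b"
  shows "piecewise_regular_on (\<lambda>t. \<gamma> (C - t)) (C - b) (C - a)"
  using assms
proof (induction rule: piecewise_regular_on_induct)
  case refl
  show ?case by (rule piecewise_regular_on_refl)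
next
  case (step b c)
  have "piecewise_regular_on (\<lambda>t. \<gamma> (C - t)) (C - c) (C - b)"
    using step by (intro piecewise_regular_on_step[OF piecewise_regular_on_refl] C1_regular_on_reflect) auto
  then show ?case
    using step.IH by (rule piecewise_regular_on_trans)
qed

text \<open>Two-sided differentiability fails at most at the break points, which are negligible both for
  integrals and for the fundamental theorem of calculus.\<close>

lemma piecewise_regular_on_differentiable:
  assumes "piecewise_regular_on \<gamma> a b"
  obtains S where "finite S"
    "\<And>t. t \<in> {a<..<b} - S \<Longrightarrow> (\<gamma> has_vector_derivative vector_derivative \<gamma> (at t)) (at t)"
proof -
  have "\<exists>S. finite S \<and> (\<forall>t\<in>{a<..<b} - S. (\<gamma> has_vector_derivative vector_derivative \<gamma> (at t)) (at t))"
    using assms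
  proof (induction rule: piecewise_regular_on_induct)
    case refl
    show ?case by auto
  next
    case (step b c)
    then obtain S where S: "finite S"
      "\<forall>t\<in>{a<..<b} - S. (\<gamma> has_vector_derivative vector_derivative \<gamma> (at t)) (at t)"
      by blast
    have "(\<gamma> has_vector_derivative vector_derivative \<gamma> (at t)) (at t)" if "t \<in> {b<..<c}" for t
    proof -
      have "\<exists>D. (\<gamma> has_vector_derivative D) (at t within {b..c})"
        using step(4) that unfolding C1_regular_on_def by (meson greaterThanLessThan_subseteq_atLeastAtMost_iff order_refl subsetD)
      then show ?thesis
        using that at_within_interior[of t "{b..c}"]
        by (metis interior_atLeastAtMost_real vector_derivative_at)
    qed
    then have "(\<gamma> has_vector_derivative vector_derivative \<gamma> (at t)) (at t)"
      if "t \<in> {a<..<c} - insert b S" for t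
      using that S(2) by (cases "t < b") auto
    then show ?case
      using S(1) by (intro exI[of _ "insert b S"]) auto
  qed
  then show thesis using that by blast
qed

section \<open>Length as the integral of speed\<close>

text \<open>Unlike the integrand of \<^const>\<open>curve_length\<close>, the speed does not refer to the ends of the
  parameter interval, so that lengths add up over adjacent intervals.\<close>

definition speed :: "(real^'n \<Rightarrow> real^'n^'n) \<Rightarrow> (real \<Rightarrow> real^'n) \<Rightarrow> real \<Rightarrow> real" where
  "speed M \<gamma> t = mnorm (M (\<gamma> t)) (vector_derivative \<gamma> (at t))"

lemma curve_length_eq_integral_speed: "curve_length M a b \<gamma> = integral {a..b} (speed M \<gamma>)"
  unfolding curve_length_def
proof (rule integral_spike[of "{a, b}"])
  fix t assume "t \<in> {a..b} - {a, b}"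
  then have "at t within {a..b} = at t"
    by (intro at_within_interior) auto
  then show "speed M \<gamma> t = (let v = vector_derivative \<gamma> (at t within {a..b}) in sqrt (v \<bullet> (M (\<gamma> t) *v v)))"
    by (simp add: speed_def mnorm_def Let_def)
qed auto

lemma speed_eq:
  assumes "(\<gamma> has_vector_derivative D) (at t)"
  shows "speed M \<gamma> t = mnorm (M (\<gamma> t)) D"
  using vector_derivative_at[OF assms] by (simp add: speed_def)

text \<open>On each piece the speed agrees, except possibly at the two ends, with a function built from the
  one-sided derivative, which is continuous up to the ends.\<close>

lemma speed_integrable:
  assumes adm: "admissible_curve X a b \<gamma>" and M: "continuous_on X M"
  shows "speed M \<gamma> integrable_on {a..b}"
proof -
  have im: "\<gamma> ` {a..b} \<subseteq> X" and cont: "continuous_on {a..b} \<gamma>" and pw: "piecewise_regular_on \<gamma> a b"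
    using adm by (auto simp: admissible_curve_def)
  have "\<gamma> ` {a..b} \<subseteq> X \<and> continuous_on {a..b} \<gamma> \<longrightarrow> speed M \<gamma> integrable_on {a..b}"
    using pw
  proof (induction rule: piecewise_regular_on_induct)
    case refl
    show ?case using integrable_on_refl[of "speed M \<gamma>" a] by simp
  next
    case (step b c)
    show ?case
    proof
      assume *: "\<gamma> ` {a..c} \<subseteq> X \<and> continuous_on {a..c} \<gamma>"
      have sub: "{a..b} \<subseteq> {a..c}" "{b..c} \<subseteq> {a..c}"
        using step by auto
      have "speed M \<gamma> integrable_on {a..b}"
        using step.IH * sub(1) by (meson continuous_on_subset image_mono subset_trans)
      moreover have "speed M \<gamma> integrable_on {b..c}"
      proof -
        obtain \<gamma>' where c': "continuous_on {b..c} \<gamma>'"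
          and der: "\<And>t. t \<in> {b..c} \<Longrightarrow> (\<gamma> has_vector_derivative \<gamma>' t) (at t within {b..c})"
          using step(4) unfolding C1_regular_on_def by blast
        have "continuous_on {b..c} \<gamma>" "\<gamma> ` {b..c} \<subseteq> X"
          using * sub(2) continuous_on_subset by blast+
        then have "continuous_on {b..c} (\<lambda>t. M (\<gamma> t))"
          by (intro continuous_on_compose2[OF M]) auto
        then have "(\<lambda>t. mnorm (M (\<gamma> t)) (\<gamma>' t)) integrable_on {b..c}"
          by (intro integrable_continuous_real continuous_on_mnorm c')
        then show ?thesis
        proof (rule integrable_spike[of _ _ "{b, c}"])
          fix t assume t: "t \<in> {b..c} - {b, c}"
          then have "at t within {b..c} = at t"
            by (intro at_within_interior) auto
          then show "speed M \<gamma> t = mnorm (M (\<gamma> t)) (\<gamma>' t)"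
            using der[of t] t by (intro speed_eq) auto
        qed auto
      qed
      ultimately show "speed M \<gamma> integrable_on {a..c}"
        using step by (intro Henstock_Kurzweil_Integration.integrable_combine[of a b c]) auto
    qed
  qed
  with im cont show ?thesis by blast
qed

lemma speed_nonneg: "pos_def (M (\<gamma> t)) \<Longrightarrow> 0 \<le> speed M \<gamma> t"
  by (simp add: speed_def mnorm_nonneg)

lemma admissible_curve_velocity_has_integral:
  assumes adm: "admissible_curve X a b \<gamma>" and st: "a \<le> s" "s \<le> t" "t \<le> b"
  shows "((\<lambda>r. vector_derivative \<gamma> (at r)) has_integral \<gamma> t - \<gamma> s) {s..t}"
proof -
  obtain S where "finite S"
    "\<And>r. r \<in> {a<..<b} - S \<Longrightarrow> (\<gamma> has_vector_derivative vector_derivative \<gamma> (at r)) (at r)"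
    using piecewise_regular_on_differentiable adm by (metis admissible_curve_def)
  moreover have "continuous_on {s..t} \<gamma>"
    using adm st by (meson admissible_curve_def atLeastatMost_subset_iff continuous_on_subset)
  ultimately show ?thesis
    using st by (intro fundamental_theorem_of_calculus_interior_strong[of S]) auto
qed

text \<open>A curve moving in a fixed norm is at least as long as its chord. Rather than a triangle
  inequality for integrals in that norm, the proof tests the velocity against the chord \<open>u\<close>:
  \<open>|u|\<^sup>2 = \<integral> \<langle>u, \<gamma>'\<rangle> \<le> |u| \<integral> |\<gamma>'|\<close>. The factor \<open>K\<close> allows the speed to be measured in a metric
  that varies along the curve.\<close>

lemma chord_le_integral_speed:
  fixes A :: "real^'n^'n"
  assumes adm: "admissible_curve X a b \<gamma>" and M: "continuous_on X M"
    and st: "a \<le> s" "s \<le> t" "t \<le> b" and A: "pos_def A"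
    and K: "\<And>r v. r \<in> {s..t} \<Longrightarrow> mnorm A v \<le> K * mnorm (M (\<gamma> r)) v"
  shows "mnorm A (\<gamma> t - \<gamma> s) \<le> K * integral {s..t} (speed M \<gamma>)"
proof -
  define u where "u = \<gamma> t - \<gamma> s"
  have int: "speed M \<gamma> integrable_on {s..t}"
    using speed_integrable[OF adm M] st by (elim integrable_on_subinterval) auto
  have "bounded_linear (\<lambda>v. u \<bullet> (A *v v))"
    by (rule bounded_linear_compose[OF bounded_linear_inner_right matrix_vector_mul_bounded_linear])
  from has_integral_linear[OF admissible_curve_velocity_has_integral[OF adm st] this]
  have "((\<lambda>r. u \<bullet> (A *v vector_derivative \<gamma> (at r))) has_integral (mnorm A u)\<^sup>2) {s..t}"
    using A by (simp add: o_def mnorm_power2 flip: u_def)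
  moreover have "((\<lambda>r. mnorm A u * (K * speed M \<gamma> r)) has_integral
      mnorm A u * (K * integral {s..t} (speed M \<gamma>))) {s..t}"
    using int by (intro has_integral_mult_right) (rule integrable_integral)
  moreover have "u \<bullet> (A *v vector_derivative \<gamma> (at r)) \<le> mnorm A u * (K * speed M \<gamma> r)"
    if "r \<in> {s..t}" for r
    using mnorm_Cauchy_Schwarz[OF A] K[OF that] mnorm_nonneg[OF A] unfolding speed_def
    by (meson mult_left_mono order_trans)
  ultimately have "(mnorm A u)\<^sup>2 \<le> mnorm A u * (K * integral {s..t} (speed M \<gamma>))"
    by (rule has_integral_le)
  moreover have "0 \<le> K * integral {s..t} (speed M \<gamma>)"
  proof -
    have "0 \<le> K * speed M \<gamma> r" if "r \<in> {s..t}" for r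
      using K[OF that] mnorm_nonneg[OF A] unfolding speed_def by (meson order_trans)
    then have "0 \<le> integral {s..t} (\<lambda>r. K * speed M \<gamma> r)"
      using integrable_on_cmult_left[OF int, of K] by (intro integral_nonneg) auto
    then show ?thesis by simp
  qed
  ultimately show ?thesis
    unfolding u_def[symmetric] using mnorm_nonneg[OF A, of u]
    by (cases "mnorm A u = 0") (auto simp: power2_eq_square)
qed

section \<open>Reversing, joining and constructing curves\<close>

text \<open>Reflection reverses a curve, and two reflections translate its parameter interval, so this
  one reparametrization serves both the symmetry and the triangle inequality of the path metric.
  The condition \<open>b \<le> C\<close> keeps parameters nonnegative.\<close>

lemma admissible_curve_reflect:
  assumes adm: "admissible_curve X a b \<gamma>" and "b \<le> C"
  shows "admissible_curve X (C - b) (C - a) (\<lambda>t. \<gamma> (C - t))"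
proof -
  have "continuous_on {C - b..C - a} (\<lambda>t. \<gamma> (C - t))"
  proof (rule continuous_on_compose2[of "{a..b}" \<gamma>])
    show "continuous_on {a..b} \<gamma>"
      using adm by (simp add: admissible_curve_def)
    show "continuous_on {C - b..C - a} (\<lambda>t. C - t)"
      by (intro continuous_intros)
  qed auto
  moreover have "piecewise_regular_on (\<lambda>t. \<gamma> (C - t)) (C - b) (C - a)"
    using adm by (intro piecewise_regular_on_reflect) (simp add: admissible_curve_def)
  ultimately show ?thesis
    using assms by (auto simp: admissible_curve_def image_subset_iff)
qed

lemma curve_length_reflect:
  assumes adm: "admissible_curve X a b \<gamma>"
  shows "curve_length M (C - b) (C - a) (\<lambda>t. \<gamma> (C - t)) = curve_length M a b \<gamma>"
proof -
  obtain S where "finite S"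
    and S: "\<And>r. r \<in> {a<..<b} - S \<Longrightarrow> (\<gamma> has_vector_derivative vector_derivative \<gamma> (at r)) (at r)"
    using piecewise_regular_on_differentiable adm by (metis admissible_curve_def)
  let ?N = "(\<lambda>r. C - r) ` (S \<union> {a, b})"
  have "speed M (\<lambda>t. \<gamma> (C - t)) t = speed M \<gamma> (C - t)" if "t \<in> {C - b..C - a} - ?N" for t
  proof -
    have "C - t \<in> {a<..<b} - S"
      using that by (force simp: image_iff)
    from S[OF this] have d: "(\<gamma> has_vector_derivative vector_derivative \<gamma> (at (C - t))) (at (C - t))" .
    have "((\<lambda>t. C - t) has_vector_derivative -1) (at t)"
      by (auto intro!: derivative_eq_intros)
    from vector_diff_chain_at[OF this d]
    have "((\<lambda>t. \<gamma> (C - t)) has_vector_derivative - vector_derivative \<gamma> (at (C - t))) (at t)"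
      by (simp add: o_def)
    then show ?thesis
      by (simp add: speed_eq speed_def vector_derivative_at)
  qed
  then have "integral {C - b..C - a} (speed M (\<lambda>t. \<gamma> (C - t)))
      = integral {C - b..C - a} (\<lambda>t. speed M \<gamma> (C - t))"
    using \<open>finite S\<close> by (intro integral_spike[of ?N]) (auto intro: negligible_finite)
  also have "\<dots> = integral {- b..- a} (\<lambda>t. speed M \<gamma> (- t))"
    using integral_shift_real_ivl[of "C - b" C "C - a" "\<lambda>t. speed M \<gamma> (C - t)"] by simp
  also have "\<dots> = integral {a..b} (speed M \<gamma>)"
    by (rule Henstock_Kurzweil_Integration.integral_reflect_real)
  finally show ?thesis
    by (simp add: curve_length_eq_integral_speed)
qed

lemma admissible_curve_join:
  assumes \<gamma>: "admissible_curve X a b \<gamma>" and \<zeta>: "admissible_curve X b c \<zeta>" and eq: "\<gamma> b = \<zeta> b"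
  defines "\<xi> \<equiv> \<lambda>t. if t \<le> b then \<gamma> t else \<zeta> t"
  shows "admissible_curve X a c \<xi>"
proof -
  have le: "a \<le> b" "b \<le> c"
    using assms by (auto simp: admissible_curve_def)
  have "piecewise_regular_on \<xi> a b"
    by (rule piecewise_regular_on_cong[of \<gamma>]) (use \<gamma> in \<open>auto simp: \<xi>_def admissible_curve_def\<close>)
  moreover have "piecewise_regular_on \<xi> b c"
    by (rule piecewise_regular_on_cong[of \<zeta>]) (use \<zeta> eq in \<open>auto simp: \<xi>_def admissible_curve_def\<close>)
  ultimately have "piecewise_regular_on \<xi> a c"
    by (rule piecewise_regular_on_trans)
  moreover have "continuous_on ({a..b} \<union> {b..c}) \<xi>"
    unfolding \<xi>_def
    by (rule continuous_on_If) (use \<gamma> \<zeta> eq in \<open>auto simp: admissible_curve_def\<close>)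
  moreover have "{a..b} \<union> {b..c} = {a..c}"
    using le by auto
  ultimately show ?thesis
    using \<gamma> \<zeta> by (auto simp: admissible_curve_def \<xi>_def image_subset_iff)
qed

lemma curve_length_join:
  assumes \<gamma>: "admissible_curve X a b \<gamma>" and \<zeta>: "admissible_curve X b c \<zeta>" and eq: "\<gamma> b = \<zeta> b"
    and M: "continuous_on X M"
  defines "\<xi> \<equiv> \<lambda>t. if t \<le> b then \<gamma> t else \<zeta> t"
  shows "curve_length M a c \<xi> = curve_length M a b \<gamma> + curve_length M b c \<zeta>"
proof -
  have le: "a \<le> b" "b \<le> c"
    using assms by (auto simp: admissible_curve_def)
  have "speed M \<xi> integrable_on {a..c}"
    using speed_integrable[OF admissible_curve_join[OF \<gamma> \<zeta> eq] M] by (simp add: \<xi>_def)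
  from Henstock_Kurzweil_Integration.integral_combine[OF le this]
  have "curve_length M a c \<xi> = integral {a..b} (speed M \<xi>) + integral {b..c} (speed M \<xi>)"
    by (simp add: curve_length_eq_integral_speed)
  moreover have "integral {a..b} (speed M \<xi>) = integral {a..b} (speed M \<gamma>)"
  proof (rule integral_spike[of "{b}"])
    fix t assume t: "t \<in> {a..b} - {b}"
    have "eventually (\<lambda>r. r < b) (nhds t)"
      using t by (intro order_tendstoD(2)[OF filterlim_ident]) auto
    then have "eventually (\<lambda>r. \<xi> r = \<gamma> r) (nhds t)"
      by eventually_elim (simp add: \<xi>_def)
    then have "vector_derivative \<xi> (at t) = vector_derivative \<gamma> (at t)"
      by (intro vector_derivative_cong_eq) (auto simp: eventually_mono)
    then show "speed M \<gamma> t = speed M \<xi> t"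
      using t by (simp add: speed_def \<xi>_def)
  qed auto
  moreover have "integral {b..c} (speed M \<xi>) = integral {b..c} (speed M \<zeta>)"
  proof (rule integral_spike[of "{b}"])
    fix t assume t: "t \<in> {b..c} - {b}"
    have "eventually (\<lambda>r. r > b) (nhds t)"
      using t by (intro order_tendstoD(1)[OF filterlim_ident]) auto
    then have "eventually (\<lambda>r. \<xi> r = \<zeta> r) (nhds t)"
      by eventually_elim (simp add: \<xi>_def)
    then have "vector_derivative \<xi> (at t) = vector_derivative \<zeta> (at t)"
      by (intro vector_derivative_cong_eq) (auto simp: eventually_mono)
    then show "speed M \<zeta> t = speed M \<xi> t"
      using t by (simp add: speed_def \<xi>_def)
  qed auto
  ultimately show ?thesis
    by (simp add: curve_length_eq_integral_speed)
qed

lemma has_vector_derivative_segment: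
  "((\<lambda>t. p + t *\<^sub>R (q - p)) has_vector_derivative (q - p)) (at t within S)"
  by (auto intro!: derivative_eq_intros)

lemma in_closed_segment:
  "0 \<le> t \<Longrightarrow> t \<le> 1 \<Longrightarrow> p + t *\<^sub>R (q - p) \<in> closed_segment p q"
  unfolding closed_segment_def by (intro CollectI exI[of _ t]) (simp add: algebra_simps)

lemma admissible_curve_segment:
  assumes "p \<noteq> q" and "closed_segment p q \<subseteq> X"
  shows "admissible_curve X 0 1 (\<lambda>t. p + t *\<^sub>R (q - p))"
proof -
  have "C1_regular_on (\<lambda>t. p + t *\<^sub>R (q - p)) 0 1"
    unfolding C1_regular_on_def using assms(1)
    by (intro exI[of _ "\<lambda>_. q - p"]) (auto intro!: has_vector_derivative_segment)
  then have "piecewise_regular_on (\<lambda>t. p + t *\<^sub>R (q - p)) 0 1"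
    by (intro piecewise_regular_on_step[OF piecewise_regular_on_refl]) auto
  moreover have "(\<lambda>t. p + t *\<^sub>R (q - p)) ` {0..1} \<subseteq> X"
    using assms(2) in_closed_segment by fastforce
  ultimately show ?thesis
    by (auto simp: admissible_curve_def intro!: continuous_intros)
qed

section \<open>The path metric\<close>

locale riemannian_domain =
  fixes X :: "(real^'n) set" and M :: "real^'n \<Rightarrow> real^'n^'n" and \<mu> :: real
  assumes open_X: "open X" and connected_X: "connected X"
    and continuous_M: "continuous_on X M"
    and pos_def_M: "x \<in> X \<Longrightarrow> pos_def (M x)"
    and \<mu>_pos: "\<mu> > 0"
    and lower_bound: "x \<in> X \<Longrightarrow> loewner_le (\<mu> *\<^sub>R mat 1) (M x)"
begin

abbreviation len :: "real \<times> real \<times> (real \<Rightarrow> real^'n) \<Rightarrow> real" where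
  "len \<equiv> \<lambda>(a, b, \<gamma>). curve_length M a b \<gamma>"

text \<open>Compare \<open>M\<close> with the constant metric \<open>\<mu> I\<close>, for which the chord is the shortest curve.\<close>

lemma curve_length_ge_norm:
  assumes adm: "admissible_curve X a b \<gamma>"
  shows "sqrt \<mu> * norm (\<gamma> b - \<gamma> a) \<le> curve_length M a b \<gamma>"
proof -
  have ab: "a \<le> b" and im: "\<gamma> ` {a..b} \<subseteq> X"
    using adm by (auto simp: admissible_curve_def)
  have "norm (\<gamma> b - \<gamma> a) \<le> integral {a..b} (\<lambda>t. speed M \<gamma> t / sqrt \<mu>)"
  proof -
    have "norm (integral {a..b} (\<lambda>t. vector_derivative \<gamma> (at t))) \<le> integral {a..b} (\<lambda>t. speed M \<gamma> t / sqrt \<mu>)"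
    proof (rule Henstock_Kurzweil_Integration.integral_norm_bound_integral)
      show "(\<lambda>t. vector_derivative \<gamma> (at t)) integrable_on {a..b}"
        using admissible_curve_velocity_has_integral[OF adm order_refl ab order_refl] by blast
      show "(\<lambda>t. speed M \<gamma> t / sqrt \<mu>) integrable_on {a..b}"
        using integrable_on_cmult_left[OF speed_integrable[OF adm continuous_M], of "1 / sqrt \<mu>"] by simp
      show "norm (vector_derivative \<gamma> (at t)) \<le> speed M \<gamma> t / sqrt \<mu>" if "t \<in> {a..b}" for t
      proof -
        have "\<gamma> t \<in> X"
          using im that by auto
        from norm_le_mnorm[OF lower_bound[OF this] \<mu>_pos] show ?thesis
          using \<mu>_pos by (simp add: speed_def field_simps)
      qed
    qed
    then show ?thesis
      using admissible_curve_velocity_has_integral[OF adm order_refl ab order_refl]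
      by (simp add: integral_unique)
  qed
  then show ?thesis
    using \<mu>_pos by (simp add: curve_length_eq_integral_speed field_simps)
qed

lemma len_ge_norm: "c \<in> admissible_curves_between X x y \<Longrightarrow> sqrt \<mu> * norm (y - x) \<le> len c"
  using curve_length_ge_norm by (auto simp: admissible_curves_between_def)

lemma len_nonneg: "c \<in> admissible_curves_between X x y \<Longrightarrow> 0 \<le> len c"
  using len_ge_norm[of c x y] \<mu>_pos by (meson mult_nonneg_nonneg norm_ge_zero order_trans real_sqrt_ge_zero less_imp_le)

lemma bdd_below_len: "bdd_below (len ` admissible_curves_between X x y)"
  by (rule bdd_belowI2[of _ 0]) (rule len_nonneg)

lemma constant_curve:
  assumes "x \<in> X"
  obtains c where "c \<in> admissible_curves_between X x x" "len c = 0"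
proof
  show "(0, 0, \<lambda>_. x) \<in> admissible_curves_between X x x"
    using assms by (simp add: admissible_curves_between_def admissible_curve_def piecewise_regular_on_refl)
  show "len (0, 0, \<lambda>_. x) = 0"
    by (simp add: curve_length_def)
qed

lemma reversed_curve:
  assumes "c \<in> admissible_curves_between X x y"
  obtains c' where "c' \<in> admissible_curves_between X y x" "len c' = len c"
proof -
  obtain a b \<gamma> where c: "c = (a, b, \<gamma>)" by (cases c)
  with assms have adm: "admissible_curve X a b \<gamma>" and "\<gamma> a = x" "\<gamma> b = y"
    by (auto simp: admissible_curves_between_def)
  show thesis
  proof (rule that[of "(b - b, b - a, \<lambda>t. \<gamma> (b - t))"])
    show "(b - b, b - a, \<lambda>t. \<gamma> (b - t)) \<in> admissible_curves_between X y x"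
      using admissible_curve_reflect[OF adm order_refl] \<open>\<gamma> a = x\<close> \<open>\<gamma> b = y\<close>
      by (simp add: admissible_curves_between_def)
    show "len (b - b, b - a, \<lambda>t. \<gamma> (b - t)) = len c"
      using curve_length_reflect[OF adm, of M b] by (simp only: c prod.case)
  qed
qed

lemma joined_curve:
  assumes "c \<in> admissible_curves_between X x y" and "c' \<in> admissible_curves_between X y z"
  obtains c'' where "c'' \<in> admissible_curves_between X x z" "len c'' = len c + len c'"
proof -
  obtain a b \<gamma> where c: "c = (a, b, \<gamma>)" by (cases c)
  with assms have adm: "admissible_curve X a b \<gamma>" and \<gamma>: "\<gamma> a = x" "\<gamma> b = y"
    by (auto simp: admissible_curves_between_def)
  obtain r where r: "r \<in> admissible_curves_between X z y" "len r = len c'"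
    using reversed_curve[OF assms(2)] .
  obtain d e \<zeta> where re: "r = (d, e, \<zeta>)" by (cases r)
  with r have adm': "admissible_curve X d e \<zeta>" and \<zeta>: "\<zeta> d = z" "\<zeta> e = y"
    by (auto simp: admissible_curves_between_def)
  \<comment> \<open>Reflecting the reversed second curve makes it start at the parameter where the first ends.\<close>
  define C where "C = b + e"
  have "e \<le> C"
    using adm by (simp add: C_def admissible_curve_def)
  have Ce: "C - e = b"
    by (simp add: C_def)
  have adm'': "admissible_curve X b (C - d) (\<lambda>t. \<zeta> (C - t))"
    using admissible_curve_reflect[OF adm' \<open>e \<le> C\<close>] by (simp only: Ce)
  have len'': "curve_length M b (C - d) (\<lambda>t. \<zeta> (C - t)) = len c'"
    using curve_length_reflect[OF adm', of M C] r(2) by (simp add: Ce re)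
  have eq: "\<gamma> b = \<zeta> (C - b)"
    by (simp add: \<gamma> \<zeta> C_def)
  have le: "a \<le> b" "b \<le> C - d"
    using adm adm'' by (auto simp: admissible_curve_def)
  show thesis
  proof (rule that[of "(a, C - d, \<lambda>t. if t \<le> b then \<gamma> t else \<zeta> (C - t))"])
    show "(a, C - d, \<lambda>t. if t \<le> b then \<gamma> t else \<zeta> (C - t)) \<in> admissible_curves_between X x z"
      using admissible_curve_join[OF adm adm'' eq] le \<gamma> \<zeta> eq
      by (auto simp: admissible_curves_between_def C_def)
    show "len (a, C - d, \<lambda>t. if t \<le> b then \<gamma> t else \<zeta> (C - t)) = len c + len c'"
      using curve_length_join[OF adm adm'' eq continuous_M] len'' by (simp add: c)
  qed
qed

text \<open>Being joined by an admissible curve is an equivalence relation, and its classes are open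
  because nearby points are joined by a segment.\<close>

lemma admissible_curves_nonempty:
  assumes "x \<in> X" and "y \<in> X"
  shows "admissible_curves_between X x y \<noteq> {}"
  using connected_X assms
proof (rule connected_equivalence_relation[where R = "\<lambda>x y. admissible_curves_between X x y \<noteq> {}"])
  show "admissible_curves_between X y x \<noteq> {}" if "admissible_curves_between X x y \<noteq> {}" for x y
  proof -
    obtain c where "c \<in> admissible_curves_between X x y"
      using \<open>admissible_curves_between X x y \<noteq> {}\<close> by blast
    then obtain c' where "c' \<in> admissible_curves_between X y x"
      by (rule reversed_curve)
    then show ?thesis by blast
  qed
  show "admissible_curves_between X x z \<noteq> {}"
    if "admissible_curves_between X x y \<noteq> {}" and "admissible_curves_between X y z \<noteq> {}" for x y z
  proof -
    obtain c c' where "c \<in> admissible_curves_between X x y" "c' \<in> admissible_curves_between X y z"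
      using \<open>admissible_curves_between X x y \<noteq> {}\<close> \<open>admissible_curves_between X y z \<noteq> {}\<close> by blast
    then obtain c'' where "c'' \<in> admissible_curves_between X x z"
      by (rule joined_curve)
    then show ?thesis by blast
  qed
  fix p assume "p \<in> X"
  then obtain r where r: "r > 0" "ball p r \<subseteq> X"
    using open_X open_contains_ball by metis
  have "admissible_curves_between X p q \<noteq> {}" if "q \<in> ball p r" for q
  proof (cases "p = q")
    case True
    obtain c where "c \<in> admissible_curves_between X p p"
      using constant_curve[OF \<open>p \<in> X\<close>] .
    then show ?thesis using True by blast
  next
    case False
    have "closed_segment p q \<subseteq> ball p r"
      using that r by (intro closed_segment_subset convex_ball) auto
    then have "(0, 1, \<lambda>t. p + t *\<^sub>R (q - p)) \<in> admissible_curves_between X p q"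
      using admissible_curve_segment[OF False, of X] r by (auto simp: admissible_curves_between_def)
    then show ?thesis by blast
  qed
  moreover have "openin (top_of_set X) (ball p r)"
    using open_X r by (simp add: openin_open_eq)
  ultimately show "\<exists>T. openin (top_of_set X) T \<and> p \<in> T \<and> (\<forall>q\<in>T. admissible_curves_between X p q \<noteq> {})"
    using r(1) by (intro exI[of _ "ball p r"]) auto
qed

lemma curve_dist_le_len:
  assumes "x \<in> X" "y \<in> X" "c \<in> admissible_curves_between X x y"
  shows "curve_dist X M x y \<le> len c"
  using cINF_lower[OF bdd_below_len assms(3)] assms by (simp add: curve_dist_def)

lemma curve_dist_greatest:
  assumes "x \<in> X" "y \<in> X" "\<And>c. c \<in> admissible_curves_between X x y \<Longrightarrow> m \<le> len c"
  shows "m \<le> curve_dist X M x y"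
  using cINF_greatest[OF admissible_curves_nonempty[OF assms(1,2)], of m len] assms
  by (simp add: curve_dist_def)

lemma curve_dist_le_if_reversed:
  assumes "x \<in> X" "y \<in> X"
  shows "curve_dist X M x y \<le> curve_dist X M y x"
proof (rule curve_dist_greatest[OF assms(2,1)])
  fix c assume "c \<in> admissible_curves_between X y x"
  then obtain c' where "c' \<in> admissible_curves_between X x y" "len c' = len c"
    by (rule reversed_curve)
  then show "curve_dist X M x y \<le> len c"
    using curve_dist_le_len[OF assms] by metis
qed

lemma curve_dist_triangle:
  assumes "x \<in> X" "y \<in> X" "z \<in> X"
  shows "curve_dist X M x z \<le> curve_dist X M x y + curve_dist X M y z"
proof -
  have "curve_dist X M x z - curve_dist X M x y \<le> curve_dist X M y z"
  proof (rule curve_dist_greatest[OF assms(2,3)])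
    fix c' assume c': "c' \<in> admissible_curves_between X y z"
    have "curve_dist X M x z - len c' \<le> curve_dist X M x y"
    proof (rule curve_dist_greatest[OF assms(1,2)])
      fix c assume "c \<in> admissible_curves_between X x y"
      then obtain c'' where "c'' \<in> admissible_curves_between X x z" "len c'' = len c + len c'"
        using c' by (rule joined_curve)
      then show "curve_dist X M x z - len c' \<le> len c"
        using curve_dist_le_len[OF assms(1,3)] by fastforce
    qed
    then show "curve_dist X M x z - curve_dist X M x y \<le> len c'"
      by linarith
  qed
  then show ?thesis by linarith
qed

lemma curve_dist_refl:
  assumes "x \<in> X"
  shows "curve_dist X M x x \<le> 0"
proof -
  obtain c where "c \<in> admissible_curves_between X x x" "len c = 0"
    using constant_curve[OF assms] .
  then show ?thesis
    using curve_dist_le_len[OF assms assms] by fastforce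
qed

lemma curve_dist_ge_norm:
  assumes "x \<in> X" "y \<in> X"
  shows "sqrt \<mu> * norm (y - x) \<le> curve_dist X M x y"
  using assms by (intro curve_dist_greatest len_ge_norm)

lemma Metric_space_curve_dist: "Metric_space X (curve_dist X M)"
proof
  fix x y
  show nonneg: "0 \<le> curve_dist X M x y"
  proof (cases "x \<in> X \<and> y \<in> X")
    case True
    then show ?thesis using curve_dist_greatest len_nonneg by blast
  qed (auto simp: curve_dist_def)
  show "curve_dist X M x y = curve_dist X M y x"
  proof (cases "x \<in> X \<and> y \<in> X")
    case True
    then show ?thesis by (simp add: antisym curve_dist_le_if_reversed)
  qed (auto simp: curve_dist_def)
  show "curve_dist X M x y = 0 \<longleftrightarrow> x = y" if "x \<in> X" "y \<in> X"
  proof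
    assume "curve_dist X M x y = 0"
    then show "x = y"
      using curve_dist_ge_norm[OF that] \<mu>_pos by (simp add: mult_le_0_iff not_le)
  next
    assume "x = y"
    then show "curve_dist X M x y = 0"
      using curve_dist_refl[OF that(1)] nonneg by simp
  qed
qed (rule curve_dist_triangle)

text \<open>The opposite of the chord estimate: a short segment is hardly longer than its length in the
  norm frozen at its initial point.\<close>

lemma curve_dist_le_segment:
  assumes seg: "closed_segment p q \<subseteq> X"
    and K: "\<And>z v. z \<in> closed_segment p q \<Longrightarrow> mnorm (M z) v \<le> K * mnorm (M p) v"
  shows "curve_dist X M p q \<le> K * mnorm (M p) (q - p)"
proof (cases "p = q")
  case True
  then show ?thesis using curve_dist_refl[of p] seg by simp
next
  case False
  let ?\<gamma> = "\<lambda>t. p + t *\<^sub>R (q - p)"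
  have adm: "admissible_curve X 0 1 ?\<gamma>"
    using admissible_curve_segment[OF False seg] .
  then have "(0, 1, ?\<gamma>) \<in> admissible_curves_between X p q"
    by (simp add: admissible_curves_between_def)
  then have "curve_dist X M p q \<le> curve_length M 0 1 ?\<gamma>"
    using curve_dist_le_len[of p q "(0, 1, ?\<gamma>)"] seg by (simp add: subset_eq)
  also have "\<dots> \<le> integral {0..1} (\<lambda>t::real. K * mnorm (M p) (q - p))"
    unfolding curve_length_eq_integral_speed
  proof (rule integral_le[OF speed_integrable[OF adm continuous_M]])
    show "speed M ?\<gamma> t \<le> K * mnorm (M p) (q - p)" if "t \<in> {0..1}" for t
    proof -
      have "?\<gamma> t \<in> closed_segment p q"
        using that by (intro in_closed_segment) auto
      then show ?thesis
        by (simp add: speed_eq[OF has_vector_derivative_segment] K)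
    qed
  qed auto
  finally show ?thesis by simp
qed

end

section \<open>Contraction\<close>

theorem theorem3:
  fixes f :: "real^'n \<Rightarrow> real^'n"
    and X :: "(real^'n) set"
    and M :: "real^'n \<Rightarrow> real^'n^'n"
    and \<epsilon> \<mu> \<rho> :: real
  assumes "continuous_on UNIV f"
    and "open X" and "connected X" and "forward_invariant f X"
    and "\<epsilon> > 0" and "\<mu> > 0" and "0 < \<rho>" and "\<rho> < 1"
    and "\<forall>x\<in>X. pos_def (M x)"
    and "uniformly_continuous_on X M"
    and "\<forall>x\<in>X. loewner_le (\<mu> *\<^sub>R mat 1) (M x)"
    and "\<forall>x\<in>X. \<forall>y \<in> inf_ball x \<epsilon> \<inter> X.
           sqrt ((f x - f y) \<bullet> (M (f x) *v (f x - f y))) \<le> \<rho> * sqrt ((x - y) \<bullet> (M x *v (x - y)))"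
  shows "Metric_space X (curve_dist X M) \<and> contracting_in f X (curve_dist X M)"
proof -
  interpret riemannian_domain X M \<mu>
    using assms by unfold_locales (auto intro: uniformly_continuous_imp_continuous)
  have fX: "f x \<in> X" if "x \<in> X" for x
    using assms(4) that by (auto simp: forward_invariant_def)
  have contr: "mnorm (M (f x)) (f y - f x) \<le> \<rho> * mnorm (M x) (y - x)"
    if "x \<in> X" "y \<in> X" "dist x y < \<epsilon>" for x y
  proof -
    have "y \<in> inf_ball x \<epsilon>"
      using that(3) infnorm_le_norm[of "y - x"] by (simp add: inf_ball_def dist_norm norm_minus_commute)
    then have "mnorm (M (f x)) (f x - f y) \<le> \<rho> * mnorm (M x) (x - y)"
      using assms(12) that by (simp add: mnorm_def)
    then show ?thesis
      using mnorm_minus[of "M (f x)" "f x - f y"] mnorm_minus[of "M x" "x - y"] by simp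
  qed
  \<comment> \<open>Two comparisons between nearby norms are needed, one at each end of \<open>f\<close>; with this \<open>K\<close> they
    turn the factor \<open>\<rho>\<close> into \<open>K * \<rho> * K = sqrt \<rho> < 1\<close>.\<close>
  define K where "K = sqrt (1 / sqrt \<rho>)"
  have "K > 1"
    using assms(7,8) by (simp add: K_def)
  have "K * K = 1 / sqrt \<rho>"
    using assms(7) by (simp add: K_def)
  then have "\<rho> * (K * K) = sqrt \<rho>"
    using assms(7) by (simp add: real_div_sqrt)
  then have K\<rho>: "K * (\<rho> * K) = sqrt \<rho>"
    by (simp only: mult.left_commute)
  obtain \<delta> where "\<delta> > 0" and \<delta>:
    "\<And>x y v. x \<in> X \<Longrightarrow> y \<in> X \<Longrightarrow> dist x y < \<delta> \<Longrightarrow> mnorm (M x) v \<le> K * mnorm (M y) v"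
    using mnorm_uniformly_comparable[OF assms(10,6,11,9) \<open>K > 1\<close>] by blast
  \<comment> \<open>Additivity of length and the triangle inequality make the bound on \<open>[s, t]\<close> stable under
    joining adjacent intervals, so by bisection it suffices to prove it on short ones.\<close>
  have len_bound: "curve_dist X M (f (\<gamma> a)) (f (\<gamma> b)) \<le> sqrt \<rho> * curve_length M a b \<gamma>"
    if adm: "admissible_curve X a b \<gamma>" for a b \<gamma>
  proof -
    have "a \<le> b" and cont: "continuous_on {a..b} \<gamma>" and \<gamma>X: "\<And>t. t \<in> {a..b} \<Longrightarrow> \<gamma> t \<in> X"
      using adm by (auto simp: admissible_curve_def)
    have contf: "continuous_on {a..b} (\<lambda>t. f (\<gamma> t))"
      by (rule continuous_on_compose2[OF assms(1) cont]) auto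
    have int: "speed M \<gamma> integrable_on {a..b}"
      by (rule speed_integrable[OF adm continuous_M])
    define P where "P s t \<longleftrightarrow> (a \<le> s \<and> s \<le> t \<and> t \<le> b \<longrightarrow>
      curve_dist X M (f (\<gamma> s)) (f (\<gamma> t)) \<le> sqrt \<rho> * integral {s..t} (speed M \<gamma>))" for s t
    have "P a b"
      using \<open>a \<le> b\<close>
    proof (induction rule: Bolzano)
      case (trans s t u)
      show ?case
        unfolding P_def
      proof clarify
        assume su: "a \<le> s" "s \<le> u" "u \<le> b"
        have "speed M \<gamma> integrable_on {s..u}"
          using int su by (elim integrable_on_subinterval) auto
        from Henstock_Kurzweil_Integration.integral_combine[OF trans(3,4) this]
        have "sqrt \<rho> * integral {s..u} (speed M \<gamma>)
            = sqrt \<rho> * integral {s..t} (speed M \<gamma>) + sqrt \<rho> * integral {t..u} (speed M \<gamma>)"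
          by (simp add: distrib_left flip: \<open>_ = integral {s..u} _\<close>)
        moreover have "curve_dist X M (f (\<gamma> s)) (f (\<gamma> u))
            \<le> curve_dist X M (f (\<gamma> s)) (f (\<gamma> t)) + curve_dist X M (f (\<gamma> t)) (f (\<gamma> u))"
          using trans su by (intro curve_dist_triangle fX \<gamma>X) auto
        ultimately show "curve_dist X M (f (\<gamma> s)) (f (\<gamma> u)) \<le> sqrt \<rho> * integral {s..u} (speed M \<gamma>)"
          using trans su unfolding P_def by fastforce
      qed
    next
      case (local t)
      then have t: "t \<in> {a..b}" by simp
      \<comment> \<open>How short depends on \<open>t\<close>: the images must lie in a ball inside \<open>X\<close>, so that the segment
        joining them stays in \<open>X\<close>.\<close>
      obtain r where r: "r > 0" "ball (f (\<gamma> t)) r \<subseteq> X"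
        using open_X fX[OF \<gamma>X[OF t]] open_contains_ball by metis
      obtain d1 where d1: "d1 > 0"
        "\<And>s. s \<in> {a..b} \<Longrightarrow> dist s t < d1 \<Longrightarrow> dist (\<gamma> s) (\<gamma> t) < min \<delta> \<epsilon> / 2"
        using cont t \<open>\<delta> > 0\<close> assms(5) unfolding continuous_on_iff
        by (metis half_gt_zero min_less_iff_conj)
      obtain d2 where d2: "d2 > 0"
        "\<And>s. s \<in> {a..b} \<Longrightarrow> dist s t < d2 \<Longrightarrow> dist (f (\<gamma> s)) (f (\<gamma> t)) < min r (\<delta> / 2)"
        using contf t \<open>\<delta> > 0\<close> r(1) unfolding continuous_on_iff
        by (metis half_gt_zero min_less_iff_conj)
      have "P u v" if uv: "u \<le> t" "t \<le> v" "v - u < min d1 d2" for u v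
        unfolding P_def
      proof clarify
        assume ab: "a \<le> u" "u \<le> v" "v \<le> b"
        have near: "dist s t < d1" "dist s t < d2" "s \<in> {a..b}" if "s \<in> {u..v}" for s
          using that uv ab by (auto simp: dist_real_def)
        have close: "dist (\<gamma> s) (\<gamma> s') < min \<delta> \<epsilon>" if "s \<in> {u..v}" "s' \<in> {u..v}" for s s'
          using d1(2)[OF near(3,1)[OF that(1)]] d1(2)[OF near(3,1)[OF that(2)]]
          by (rule dist_triangle_half_l)
        let ?p = "f (\<gamma> u)" and ?q = "f (\<gamma> v)"
        let ?B = "ball (f (\<gamma> t)) (min r (\<delta> / 2))"
        have pq: "?p \<in> ?B" "?q \<in> ?B"
          using d2(2)[OF near(3,2), of u] d2(2)[OF near(3,2), of v] ab by (auto simp: dist_commute)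
        have ballX: "?B \<subseteq> X"
          using r(2) by auto
        have seg: "closed_segment ?p ?q \<subseteq> ?B"
          using pq by (intro closed_segment_subset convex_ball)
        have "curve_dist X M ?p ?q \<le> K * mnorm (M ?p) (?q - ?p)"
        proof (rule curve_dist_le_segment)
          show segX: "closed_segment ?p ?q \<subseteq> X"
            using seg ballX by blast
          show "mnorm (M z) w \<le> K * mnorm (M ?p) w" if "z \<in> closed_segment ?p ?q" for z w
          proof (rule \<delta>)
            have "dist (f (\<gamma> t)) z < \<delta> / 2" "dist (f (\<gamma> t)) ?p < \<delta> / 2"
              using subsetD[OF seg that] pq by auto
            then show "dist z ?p < \<delta>"
              by (rule dist_triangle_half_r)
          qed (use that segX in auto)
        qed
        also have "\<dots> \<le> K * (\<rho> * mnorm (M (\<gamma> u)) (\<gamma> v - \<gamma> u))"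
          using \<open>K > 1\<close> close[of u v] near(3)[of u] near(3)[of v] ab
          by (intro mult_left_mono contr \<gamma>X) auto
        also have "\<dots> \<le> K * (\<rho> * (K * integral {u..v} (speed M \<gamma>)))"
        proof (intro mult_left_mono)
          have u: "\<gamma> u \<in> X"
            using near(3)[of u] ab \<gamma>X by auto
          show "mnorm (M (\<gamma> u)) (\<gamma> v - \<gamma> u) \<le> K * integral {u..v} (speed M \<gamma>)"
          proof (rule chord_le_integral_speed[OF adm continuous_M ab pos_def_M[OF u]])
            show "mnorm (M (\<gamma> u)) w \<le> K * mnorm (M (\<gamma> s)) w" if "s \<in> {u..v}" for s w
              using close[OF _ that, of u] near(3)[OF that] ab u by (intro \<delta> \<gamma>X) auto
          qed
        qed (use \<open>K > 1\<close> assms(7) in auto)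
        also have "\<dots> = sqrt \<rho> * integral {u..v} (speed M \<gamma>)"
          unfolding K\<rho>[symmetric] by simp
        finally show "curve_dist X M ?p ?q \<le> sqrt \<rho> * integral {u..v} (speed M \<gamma>)" .
      qed
      then show ?case
        using d1(1) d2(1) by (intro exI[of _ "min d1 d2"]) auto
    qed
    then show ?thesis
      using \<open>a \<le> b\<close> by (simp add: P_def curve_length_eq_integral_speed)
  qed
  have "curve_dist X M (f x) (f y) \<le> sqrt \<rho> * curve_dist X M x y" if xy: "x \<in> X" "y \<in> X" for x y
  proof -
    have "curve_dist X M (f x) (f y) / sqrt \<rho> \<le> curve_dist X M x y"
    proof (rule curve_dist_greatest[OF xy])
      fix c assume "c \<in> admissible_curves_between X x y"
      then show "curve_dist X M (f x) (f y) / sqrt \<rho> \<le> len c"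
        using len_bound assms(7) by (auto simp: admissible_curves_between_def field_simps)
    qed
    then show ?thesis
      using assms(7) by (simp add: field_simps)
  qed
  then have "contracting_in f X (curve_dist X M)"
    unfolding contracting_in_def using assms(7,8) by (intro exI[of _ "sqrt \<rho>"]) auto
  then show ?thesis
    using Metric_space_curve_dist by blast
qed

end
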